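(* Let $Y$ be a real random variable whose moment generating function $E[e^{tY}]$ exists for $|t|<r$, for some $r>0$. Let $(Y_j)_{j\ge 1}$ be mutually independent copies of $Y$, and let $S_0=0$, $S_k=Y_1+\cdots+Y_k$ for $k\ge 1$. Then for any integers $n,k$ with $n\ge k\ge 0$, $$L_{Y}(n,k)=\frac{1}{k!}\sum_{l=0}^{k}\binom{k}{l}(-1)^{k-l}E\big[\langle S_{l}\rangle_{n}\big].$$
   Context: Rising factorial: $\langle x\rangle_0=1$, $\langle x\rangle_n=x(x+1)\cdots(x+n-1)$ for $n\ge 1$. The probabilistic Lah numbers $L_Y(n,k)$ ($n\ge k\ge 0$) associated with $Y$ are defined by the power series expansion about $t=0$ $$\frac{1}{k!}\left(E\left[\left(\frac{1}{1-t}\right)^{Y}\right]-1\right)^{k}=\sum_{n=k}^{\infty}L_{Y}(n,k)\frac{t^{n}}{n!},\quad k\ge 0.$$ *)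

theory Defs
  imports "HOL-Probability.Probability"
begin

text \<open>
  Row \<^term>\<open>k\<close> of a candidate array: the sequence \<^term>\<open>c\<close> vanishes below \<^term>\<open>k\<close>
  (so the series effectively starts at \<^term>\<open>k\<close>), and its exponential generating series converges
  to the stated function on a neighbourhood of 0. There \<^prop>\<open>t < 1\<close>, so the base of
  the real power is positive.
\<close>

definition is_prob_lah_row ::
    "'a measure \<Rightarrow> ('a \<Rightarrow> real) \<Rightarrow> nat \<Rightarrow> (nat \<Rightarrow> real) \<Rightarrow> bool" where
  "is_prob_lah_row M Y k c \<longleftrightarrow>
     (\<forall>n<k. c n = 0) \<and>
     (\<forall>\<^sub>F t in nhds 0. (\<lambda>n. c n * (t ^ n / fact n)) sums
        (1 / fact k * ((\<integral>\<omega>. (1 / (1 - t)) powr Y \<omega> \<partial>M) - 1) ^ k))"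

text \<open>
  The coefficients of a power series are determined by its values near 0, so the description
  is unique as soon as such an expansion exists; it exists whenever the moment generating
  function of \<^term>\<open>Y\<close> is finite near 0.
\<close>

definition prob_lah :: "'a measure \<Rightarrow> ('a \<Rightarrow> real) \<Rightarrow> nat \<Rightarrow> nat \<Rightarrow> real" where
  "prob_lah M Y n k = (THE c. is_prob_lah_row M Y k c) n"

end

theory Submission
  imports Defs
begin

text \<open>
  Expanding \<open>(1 - t) powr - X\<close> by the binomial series and integrating termwise shows that
  \<open>E[(1 / (1 - t)) powr X]\<close> is the exponential generating function of the rising factorial moments
  of \<open>X\<close>; near 0 the series is dominated by \<open>(1 - \<bar>t\<bar>) powr - \<bar>X\<bar>\<close>, which is integrable because
  the moment generating function exists. By independence the function belonging to \<open>S\<^sub>l\<close> is the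
  \<open>l\<close>-th power of the one belonging to \<open>Y\<close>, so the binomial theorem applied to
  \<open>(E[(1 / (1 - t)) powr Y] - 1) ^ k\<close> gives the formula once coefficients are compared.
\<close>

section \<open>Uniqueness of power series expansions at 0\<close>

text \<open>Induction over the coefficient index, for all series at once: the derivative also
  vanishes near 0, and its coefficient \<open>n\<close> is \<open>Suc n\<close> times coefficient
  \<open>Suc n\<close> of \<open>F\<close>.\<close>

lemma fps_eq_0_if_eval_fps_eq_0:
  fixes F :: "'a :: {banach, real_normed_field} fps"
  assumes "fps_conv_radius F > 0" and "eventually (\<lambda>z. eval_fps F z = 0) (nhds 0)"
  shows "F = 0"
proof (rule fps_ext)
  fix n
  show "fps_nth F n = fps_nth 0 n"
    using assms
  proof (induction n arbitrary: F)
    case 0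
    have "eval_fps F 0 = 0"
      using 0(2) by (rule eventually_nhds_x_imp_x)
    then show ?case by (simp add: eval_fps_at_0)
  next
    case (Suc n F)
    have radius: "fps_conv_radius (fps_deriv F) > 0"
      using Suc.prems(1) fps_conv_radius_deriv[of F] by (rule less_le_trans)
    have "eventually (\<lambda>z::'a. z \<in> eball 0 (fps_conv_radius F)) (nhds 0)"
      using Suc.prems(1) by (intro eventually_nhds_in_open) (auto simp: zero_ereal_def)
    \<comment> \<open>Differentiating at \<open>z\<close> needs the function to vanish on a whole
      neighbourhood of \<open>z\<close>, not only at \<open>z\<close>.\<close>
    moreover have "eventually (\<lambda>z. eventually (\<lambda>w. eval_fps F w = 0) (nhds z)) (nhds 0)"
      using Suc.prems(2) by (simp add: eventually_eventually)
    ultimately have "eventually (\<lambda>z. eval_fps (fps_deriv F) z = 0) (nhds 0)"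
    proof eventually_elim
      case (elim z)
      have "(eval_fps F has_field_derivative eval_fps (fps_deriv F) z) (at z)"
        using elim(1) by (intro has_field_derivative_eval_fps) simp
      moreover have "(eval_fps F has_field_derivative 0) (at z)"
        using DERIV_cong_ev[OF refl elim(2) refl] by simp
      ultimately show ?case by (rule DERIV_unique)
    qed
    from Suc.IH[OF radius this] show ?case by (simp del: of_nat_Suc)
  qed
qed

lemma has_fps_expansion_unique:
  fixes F G :: "'a :: {banach, real_normed_field} fps"
  assumes "f has_fps_expansion F" and "f has_fps_expansion G"
  shows "F = G"
proof -
  have "(\<lambda>x. f x - f x) has_fps_expansion F - G"
    using assms by (rule has_fps_expansion_diff)
  then have "F - G = 0"
    by (intro fps_eq_0_if_eval_fps_eq_0) (simp_all add: has_fps_expansion_def)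
  then show ?thesis by simp
qed

text \<open>Translates between the \<open>sums\<close> form of \<open>is_prob_lah_row\<close> and
  the library notion of expansion, which asks for a positive radius of convergence and equality with
  \<open>eval_fps\<close> near 0.\<close>

lemma has_fps_expansion_iff_sums:
  fixes f :: "'a :: {banach, real_normed_field} \<Rightarrow> 'a"
  shows "f has_fps_expansion F \<longleftrightarrow> eventually (\<lambda>z. (\<lambda>n. fps_nth F n * z ^ n) sums f z) (nhds 0)"
proof
  assume f: "f has_fps_expansion F"
  then have "eventually (\<lambda>z::'a. z \<in> eball 0 (fps_conv_radius F)) (nhds 0)"
    by (intro eventually_nhds_in_open) (auto simp: zero_ereal_def has_fps_expansion_def)
  moreover have "eventually (\<lambda>z. eval_fps F z = f z) (nhds 0)"
    using f by (simp add: has_fps_expansion_def)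
  ultimately show "eventually (\<lambda>z. (\<lambda>n. fps_nth F n * z ^ n) sums f z) (nhds 0)"
    by eventually_elim (metis in_eball_iff dist_0_norm sums_eval_fps)
next
  assume *: "eventually (\<lambda>z. (\<lambda>n. fps_nth F n * z ^ n) sums f z) (nhds 0)"
  then obtain d where d: "d > 0" "\<And>z. dist z 0 < d \<Longrightarrow> (\<lambda>n. fps_nth F n * z ^ n) sums f z"
    unfolding eventually_nhds_metric by blast
  \<comment> \<open>Convergence at the single nonzero point \<open>d/2\<close> already bounds the
    radius from below.\<close>
  have "(\<lambda>n. fps_nth F n * of_real (d/2) ^ n) sums f (of_real (d/2))"
    using d(1) by (intro d(2)) (simp add: dist_norm norm_divide)
  then have "fps_conv_radius F \<ge> norm (of_real (d/2) :: 'a)"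
    unfolding fps_conv_radius_def by (intro conv_radius_geI) (rule sums_summable)
  moreover have "norm (of_real (d/2) :: 'a) = d / 2"
    using d(1) by (simp add: norm_divide)
  ultimately have "fps_conv_radius F \<ge> ereal (d/2)"
    by simp
  then have "fps_conv_radius F > 0"
    using d(1) by (metis ereal_less(2) half_gt_zero less_le_trans)
  moreover have "eventually (\<lambda>z. eval_fps F z = f z) (nhds 0)"
    using * by eventually_elim (simp add: eval_fps_def sums_iff)
  ultimately show "f has_fps_expansion F"
    by (simp add: has_fps_expansion_def)
qed

lemma has_fps_expansion_power:
  fixes f :: "'a :: {banach, real_normed_field} \<Rightarrow> 'a"
  assumes "f has_fps_expansion F"
  shows "(\<lambda>x. f x ^ k) has_fps_expansion F ^ k"
  using has_fps_expansion_prod[of "{..<k}" "\<lambda>_. f" "\<lambda>_. F"] assms by simp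

section \<open>Binomial series and rising factorial moments\<close>

text \<open>Newton's binomial series with exponent \<open>- x\<close> at \<open>- t\<close>; the
  signs of the coefficients and of the powers cancel.\<close>

lemma pochhammer_sums_powr:
  fixes x t :: real
  assumes "\<bar>t\<bar> < 1"
  shows "(\<lambda>m. pochhammer x m / fact m * t ^ m) sums (1 / (1 - t)) powr x"
proof -
  have "(\<lambda>m. (-x gchoose m) * (-t) ^ m) sums (1 + - t) powr - x"
    using assms by (intro gen_binomial_real) simp
  moreover have "(-x gchoose m) * (-t) ^ m = pochhammer x m / fact m * t ^ m" for m
  proof -
    have "(-x gchoose m) * (-t) ^ m = ((-1) ^ m * (-t) ^ m) * pochhammer x m / fact m"
      by (simp add: gbinomial_pochhammer)
    also have "(-1) ^ m * (-t) ^ m = t ^ m"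
      by (simp flip: power_mult_distrib)
    finally show ?thesis by simp
  qed
  moreover have "(1 + - t) powr - x = (1 / (1 - t)) powr x"
    using assms by (simp add: powr_minus_divide powr_divide)
  ultimately show ?thesis by simp
qed

lemma abs_pochhammer_le:
  fixes x :: real
  shows "\<bar>pochhammer x m\<bar> \<le> pochhammer \<bar>x\<bar> m"
  unfolding pochhammer_prod abs_prod by (intro prod_mono) auto

text \<open>Supplies the dominating function. Passing to \<open>\<bar>x\<bar>\<close> and
  \<open>\<bar>t\<bar>\<close> gives a series of nonnegative terms with known sum. The bound is
  split into exponents \<open>x\<close> and \<open>- x\<close> because the moment generating
  function controls each of them separately.\<close>

lemma pochhammer_partial_sum_le:
  fixes x t :: real
  assumes "\<bar>t\<bar> < 1"
  shows "(\<Sum>m<n. \<bar>pochhammer x m / fact m * t ^ m\<bar>)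
    \<le> (1 / (1 - \<bar>t\<bar>)) powr x + (1 / (1 - \<bar>t\<bar>)) powr (- x)"
proof -
  have "(\<Sum>m<n. \<bar>pochhammer x m / fact m * t ^ m\<bar>)
      \<le> (\<Sum>m<n. pochhammer \<bar>x\<bar> m / fact m * \<bar>t\<bar> ^ m)"
    by (intro sum_mono)
      (auto simp: abs_mult power_abs intro!: mult_right_mono divide_right_mono abs_pochhammer_le)
  also have "\<dots> \<le> (1 / (1 - \<bar>t\<bar>)) powr \<bar>x\<bar>"
  proof -
    have sums: "(\<lambda>m. pochhammer \<bar>x\<bar> m / fact m * \<bar>t\<bar> ^ m) sums (1 / (1 - \<bar>t\<bar>)) powr \<bar>x\<bar>"
      using assms by (intro pochhammer_sums_powr) simp
    have "0 \<le> pochhammer \<bar>x\<bar> m / fact m * \<bar>t\<bar> ^ m" for m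
      using order_trans[OF abs_ge_zero abs_pochhammer_le[of x m]] by simp
    then show ?thesis
      unfolding sums_unique[OF sums] by (intro sum_le_suminf sums_summable[OF sums]) auto
  qed
  also have "\<dots> \<le> (1 / (1 - \<bar>t\<bar>)) powr x + (1 / (1 - \<bar>t\<bar>)) powr (- x)"
    by (cases "x \<ge> 0") auto
  finally show ?thesis .
qed

lemma powr_eq_exp_mult:
  fixes t :: real
  assumes "t < 1"
  shows "(1 / (1 - t)) powr x = exp (- ln (1 - t) * x)"
  using assms by (simp add: powr_def ln_div)

text \<open>By \<open>powr_eq_exp_mult\<close> the moment generating function is evaluated at
  \<open>- ln (1 - t)\<close>. The bound for \<open>t\<close> serves the factorization over
  independent copies, the one for \<open>\<bar>t\<bar>\<close> the dominating function.\<close>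

lemma eventually_mgf_parameter:
  fixes r :: real
  assumes "r > 0"
  shows "\<forall>\<^sub>F t in nhds 0. \<bar>t\<bar> < 1 \<and> \<bar>ln (1 - t)\<bar> < r \<and> \<bar>ln (1 - \<bar>t\<bar>)\<bar> < r"
proof -
  have lim: "((\<lambda>t. \<bar>ln (1 - t)\<bar>) \<longlongrightarrow> \<bar>ln (1 - 0 :: real)\<bar>) (nhds 0)"
    "((\<lambda>t. \<bar>ln (1 - \<bar>t\<bar>)\<bar>) \<longlongrightarrow> \<bar>ln (1 - \<bar>0 :: real\<bar>)\<bar>) (nhds 0)"
    "((\<lambda>t. \<bar>t\<bar>) \<longlongrightarrow> \<bar>0 :: real\<bar>) (nhds 0)"
    by (intro tendsto_intros filterlim_ident; simp)+
  show ?thesis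
    using assms lim[THEN order_tendstoD(2)] by (intro eventually_conj) auto
qed

lemma fps_expansion_rising_factorial_moments:
  fixes X :: "'a \<Rightarrow> real" and r :: real
  assumes meas [measurable]: "X \<in> borel_measurable M"
    and r: "r > 0"
    and mgf: "\<And>t. \<bar>t\<bar> < r \<Longrightarrow> integrable M (\<lambda>\<omega>. exp (t * X \<omega>))"
  shows "(\<lambda>t. \<integral>\<omega>. (1 / (1 - t)) powr X \<omega> \<partial>M) has_fps_expansion
    Abs_fps (\<lambda>m. (\<integral>\<omega>. pochhammer (X \<omega>) m \<partial>M) / fact m)"
proof -
  have dom: "integrable M (\<lambda>\<omega>. (1 / (1 - \<bar>t\<bar>)) powr X \<omega> + (1 / (1 - \<bar>t\<bar>)) powr (- X \<omega>))"
    if "\<bar>t\<bar> < 1" "\<bar>ln (1 - \<bar>t\<bar>)\<bar> < r" for t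
    using that mgf[of "- ln (1 - \<bar>t\<bar>)"] mgf[of "ln (1 - \<bar>t\<bar>)"]
    by (simp add: powr_eq_exp_mult)
  have poch [measurable]: "(\<lambda>\<omega>. pochhammer (X \<omega>) m) \<in> borel_measurable M" for m
    unfolding pochhammer_prod by measurable
  \<comment> \<open>A single term of the series is below the dominating function at a fixed
    \<open>t\<close>; taking \<open>t\<close> nonzero allows \<open>t ^ m / fact m\<close> to be
    divided out.\<close>
  have int: "integrable M (\<lambda>\<omega>. pochhammer (X \<omega>) m)" for m
  proof -
    have "\<forall>\<^sub>F t in at 0. \<bar>t\<bar> < 1 \<and> \<bar>ln (1 - t)\<bar> < r \<and> \<bar>ln (1 - \<bar>t\<bar>)\<bar> < r"
      using eventually_mgf_parameter[OF r] by (simp add: eventually_nhds_conv_at)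
    moreover have "\<forall>\<^sub>F t::real in at 0. t \<noteq> 0"
      by (simp add: eventually_at_filter)
    ultimately have "\<forall>\<^sub>F t::real in at 0. \<bar>t\<bar> < 1 \<and> \<bar>ln (1 - \<bar>t\<bar>)\<bar> < r \<and> t \<noteq> 0"
      by eventually_elim blast
    then obtain t :: real where t: "\<bar>t\<bar> < 1" "\<bar>ln (1 - \<bar>t\<bar>)\<bar> < r" "t \<noteq> 0"
      using eventually_happens'[OF at_neq_bot] by blast
    have "integrable M (\<lambda>\<omega>. pochhammer (X \<omega>) m / fact m * t ^ m)"
    proof (rule Bochner_Integration.integrable_bound[OF dom[OF t(1,2)]])
      show "AE \<omega> in M. norm (pochhammer (X \<omega>) m / fact m * t ^ m)
          \<le> norm ((1 / (1 - \<bar>t\<bar>)) powr X \<omega> + (1 / (1 - \<bar>t\<bar>)) powr (- X \<omega>))"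
      proof (rule AE_I2)
        fix \<omega>
        have "\<bar>pochhammer (X \<omega>) m / fact m * t ^ m\<bar>
            \<le> (\<Sum>i<Suc m. \<bar>pochhammer (X \<omega>) i / fact i * t ^ i\<bar>)"
          by (rule member_le_sum) auto
        also note pochhammer_partial_sum_le[OF t(1)]
        finally show "norm (pochhammer (X \<omega>) m / fact m * t ^ m)
          \<le> norm ((1 / (1 - \<bar>t\<bar>)) powr X \<omega> + (1 / (1 - \<bar>t\<bar>)) powr (- X \<omega>))"
          by (simp add: abs_of_nonneg)
      qed
    qed measurable
    then have "integrable M (\<lambda>\<omega>. pochhammer (X \<omega>) m / fact m * t ^ m * (fact m / t ^ m))"
      by (rule integrable_mult_left)
    then show ?thesis using t(3) by simp
  qed
  have "\<forall>\<^sub>F t in nhds 0. (\<lambda>m. (\<integral>\<omega>. pochhammer (X \<omega>) m \<partial>M) / fact m * t ^ m) sums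
      (\<integral>\<omega>. (1 / (1 - t)) powr X \<omega> \<partial>M)"
    using eventually_mgf_parameter[OF r]
  proof eventually_elim
    case (elim t)
    then have t: "\<bar>t\<bar> < 1" "\<bar>ln (1 - \<bar>t\<bar>)\<bar> < r" by blast+
    have "(\<lambda>n. \<integral>\<omega>. (\<Sum>m<n. pochhammer (X \<omega>) m / fact m * t ^ m) \<partial>M)
        \<longlonglongrightarrow> (\<integral>\<omega>. (1 / (1 - t)) powr X \<omega> \<partial>M)"
    \<comment> \<open>Dominated convergence is applied to the partial sums, whose bound is uniform
      in \<open>n\<close>.\<close>
    proof (rule integral_dominated_convergence[OF _ _ dom[OF t]])
      show "AE \<omega> in M. (\<lambda>n. \<Sum>m<n. pochhammer (X \<omega>) m / fact m * t ^ m)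
          \<longlonglongrightarrow> (1 / (1 - t)) powr X \<omega>"
        using pochhammer_sums_powr[OF t(1)] by (simp add: sums_def)
      show "AE \<omega> in M. norm (\<Sum>m<n. pochhammer (X \<omega>) m / fact m * t ^ m)
          \<le> (1 / (1 - \<bar>t\<bar>)) powr X \<omega> + (1 / (1 - \<bar>t\<bar>)) powr (- X \<omega>)" for n
      proof (rule AE_I2)
        fix \<omega>
        have "norm (\<Sum>m<n. pochhammer (X \<omega>) m / fact m * t ^ m)
            \<le> (\<Sum>m<n. \<bar>pochhammer (X \<omega>) m / fact m * t ^ m\<bar>)"
          by (simp only: real_norm_def sum_abs)
        also note pochhammer_partial_sum_le[OF t(1)]
        finally show "norm (\<Sum>m<n. pochhammer (X \<omega>) m / fact m * t ^ m)
          \<le> (1 / (1 - \<bar>t\<bar>)) powr X \<omega> + (1 / (1 - \<bar>t\<bar>)) powr (- X \<omega>)" .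
      qed
    qed measurable
    moreover have "(\<integral>\<omega>. (\<Sum>m<n. pochhammer (X \<omega>) m / fact m * t ^ m) \<partial>M)
        = (\<Sum>m<n. (\<integral>\<omega>. pochhammer (X \<omega>) m \<partial>M) / fact m * t ^ m)" for n
      using int by (subst Bochner_Integration.integral_sum) simp_all
    ultimately show ?case by (simp add: sums_def)
  qed
  then show ?thesis by (simp add: has_fps_expansion_iff_sums)
qed

lemma (in prob_space) indep_vars_mgf_sum:
  fixes X :: "'i \<Rightarrow> 'a \<Rightarrow> real"
  assumes "finite I" and "indep_vars (\<lambda>_. borel) X I"
    and "\<And>i. i \<in> I \<Longrightarrow> integrable M (\<lambda>\<omega>. exp (t * X i \<omega>))"
  shows "integrable M (\<lambda>\<omega>. exp (t * (\<Sum>i\<in>I. X i \<omega>)))"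
    and "expectation (\<lambda>\<omega>. exp (t * (\<Sum>i\<in>I. X i \<omega>)))
      = (\<Prod>i\<in>I. expectation (\<lambda>\<omega>. exp (t * X i \<omega>)))"
proof -
  have indep: "indep_vars (\<lambda>_. borel) (\<lambda>i \<omega>. exp (t * X i \<omega>)) I"
    using assms(2) by (rule indep_vars_compose2) measurable
  show "integrable M (\<lambda>\<omega>. exp (t * (\<Sum>i\<in>I. X i \<omega>)))"
    using indep_vars_integrable[OF assms(1) indep assms(3)]
    by (simp add: sum_distrib_left exp_sum assms(1))
  show "expectation (\<lambda>\<omega>. exp (t * (\<Sum>i\<in>I. X i \<omega>)))
      = (\<Prod>i\<in>I. expectation (\<lambda>\<omega>. exp (t * X i \<omega>)))"
    using indep_vars_lebesgue_integral[OF assms(1) indep assms(3)]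
    by (simp add: sum_distrib_left exp_sum assms(1))
qed

section \<open>Rows of probabilistic Lah numbers\<close>

lemma is_prob_lah_row_iff_fps_expansion:
  "is_prob_lah_row M Y k c \<longleftrightarrow> (\<forall>n<k. c n = 0) \<and>
    (\<lambda>t. 1 / fact k * ((\<integral>\<omega>. (1 / (1 - t)) powr Y \<omega> \<partial>M) - 1) ^ k)
      has_fps_expansion Abs_fps (\<lambda>n. c n / fact n)"
  by (simp add: is_prob_lah_row_def has_fps_expansion_iff_sums)

text \<open>Uniqueness of expansions justifies the definite description, so exhibiting one valid row
  suffices.\<close>

lemma prob_lah_eqI:
  assumes c: "is_prob_lah_row M Y k c"
  shows "prob_lah M Y n k = c n"
proof -
  have "(THE c. is_prob_lah_row M Y k c) = c"
  proof (rule the_equality)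
    show "is_prob_lah_row M Y k c" by (rule c)
  next
    fix d assume "is_prob_lah_row M Y k d"
    then have "Abs_fps (\<lambda>n. d n / fact n) = Abs_fps (\<lambda>n. c n / fact n)"
      using c unfolding is_prob_lah_row_iff_fps_expansion by (blast intro: has_fps_expansion_unique)
    then show "d = c"
      by (simp add: fps_eq_iff fun_eq_iff)
  qed
  then show ?thesis by (simp add: prob_lah_def)
qed

theorem theorem2p1:
  fixes M :: "'a measure" and N :: "'b measure"
    and Y :: "'a \<Rightarrow> real" and Ys :: "nat \<Rightarrow> 'b \<Rightarrow> real"
    and r :: real and n k :: nat
  assumes "prob_space M" and "prob_space N"
    and "Y \<in> borel_measurable M"
    and "r > 0"
    and "\<And>t. \<bar>t\<bar> < r \<Longrightarrow> integrable M (\<lambda>\<omega>. exp (t * Y \<omega>))"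
    and "prob_space.indep_vars N (\<lambda>_. borel) Ys {1..}"
    and "\<And>j. j \<ge> 1 \<Longrightarrow> distr N borel (Ys j) = distr M borel Y"
    and "k \<le> n"
  shows "prob_lah M Y n k =
    1 / fact k * (\<Sum>l=0..k. real (k choose l) * (-1) ^ (k - l) *
      (\<integral>\<omega>. pochhammer (\<Sum>j=1..l. Ys j \<omega>) n \<partial>N))"
proof -
  interpret M: prob_space M by fact
  interpret N: prob_space N by fact
  note [measurable] = assms(3)
  define \<phi> where "\<phi> t = (\<integral>\<omega>. (1 / (1 - t)) powr Y \<omega> \<partial>M)" for t
  define S where "S l \<omega> = (\<Sum>j=1..l. Ys j \<omega>)" for l \<omega>
  define F where "F l = Abs_fps (\<lambda>m. (\<integral>\<omega>. pochhammer (S l \<omega>) m \<partial>N) / fact m)" for l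
  have Ys [measurable]: "Ys j \<in> borel_measurable N" if "j \<ge> 1" for j
    using assms(6) that by (auto simp: N.indep_vars_def)
  have S [measurable]: "S l \<in> borel_measurable N" for l
    unfolding S_def by (rule borel_measurable_sum) (use Ys in simp)
  \<comment> \<open>Both sides are statements about the common law of \<open>Ys j\<close> and
    \<open>Y\<close> on the reals.\<close>
  have exp_Ys: "integrable N (\<lambda>\<omega>. exp (t * Ys j \<omega>)) \<longleftrightarrow> integrable M (\<lambda>\<omega>. exp (t * Y \<omega>))"
    "(\<integral>\<omega>. exp (t * Ys j \<omega>) \<partial>N) = (\<integral>\<omega>. exp (t * Y \<omega>) \<partial>M)" if "j \<ge> 1" for t j
    using integrable_distr_eq[OF Ys[OF that], of "\<lambda>x. exp (t * x)"]
      integrable_distr_eq[OF assms(3), of "\<lambda>x. exp (t * x)"]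
      integral_distr[OF Ys[OF that], of "\<lambda>x. exp (t * x)"]
      integral_distr[OF assms(3), of "\<lambda>x. exp (t * x)"]
      assms(7)[OF that] by simp_all
  have indep: "N.indep_vars (\<lambda>_. borel) Ys {1..l}" for l
    using assms(6) by (rule N.indep_vars_subset) auto
  have mgf_S: "integrable N (\<lambda>\<omega>. exp (t * S l \<omega>))"
    "(\<integral>\<omega>. exp (t * S l \<omega>) \<partial>N) = (\<integral>\<omega>. exp (t * Y \<omega>) \<partial>M) ^ l" if "\<bar>t\<bar> < r" for t l
    using N.indep_vars_mgf_sum[OF _ indep[of l], of t] assms(5)[OF that]
    by (simp_all add: S_def exp_Ys)
  have F: "(\<lambda>t. \<integral>\<omega>. (1 / (1 - t)) powr S l \<omega> \<partial>N) has_fps_expansion F l" for l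
    unfolding F_def
    by (rule fps_expansion_rising_factorial_moments[OF S \<open>r > 0\<close> mgf_S(1)])
  have S_phi: "\<forall>\<^sub>F t in nhds 0. (\<integral>\<omega>. (1 / (1 - t)) powr S l \<omega> \<partial>N) = \<phi> t ^ l" for l
    using eventually_mgf_parameter[OF \<open>r > 0\<close>]
  proof eventually_elim
    case (elim t)
    then have "t < 1" by linarith
    with elim show ?case
      using mgf_S(2)[of "- ln (1 - t)" l] by (simp add: \<phi>_def powr_eq_exp_mult)
  qed
  \<comment> \<open>An expansion depends only on values near 0, where \<open>S_phi\<close>
    identifies the two functions.\<close>
  have F_phi: "(\<lambda>t. \<phi> t ^ l) has_fps_expansion F l" for l
    using F[of l] S_phi[of l] by (auto simp: has_fps_expansion_def elim: eventually_elim2)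
  have phi: "\<phi> has_fps_expansion F 1"
    using F_phi[of 1] by simp
  have F_power: "F l = F 1 ^ l" for l
    using F_phi[of l] has_fps_expansion_power[OF phi] by (rule has_fps_expansion_unique)
  \<comment> \<open>The claimed formula is taken for every index \<open>m\<close>, since
    \<open>prob_lah\<close> describes a whole row.\<close>
  define c where "c m = 1 / fact k * (\<Sum>l=0..k. real (k choose l) * (-1) ^ (k - l) *
      (\<integral>\<omega>. pochhammer (S l \<omega>) m \<partial>N))" for m
  define G where "G = fps_const (1 / fact k) * (F 1 - 1) ^ k"
  have binomial: "(F 1 - 1) ^ k = (\<Sum>l=0..k. fps_const (real (k choose l) * (-1) ^ (k - l)) * F l)"
  proof -
    have coeff: "fps_const (real (k choose l) * (-1) ^ (k - l))
        = of_nat (k choose l) * (-1) ^ (k - l)" for l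
      by (simp add: fps_of_nat flip: fps_const_mult fps_const_power fps_const_neg)
    have "(F 1 - 1) ^ k = (\<Sum>l\<le>k. of_nat (k choose l) * F 1 ^ l * (-1) ^ (k - l))"
      using binomial_ring[of "F 1" "-1" k] by simp
    also have "\<dots> = (\<Sum>l\<le>k. fps_const (real (k choose l) * (-1) ^ (k - l)) * F l)"
      unfolding coeff by (intro sum.cong refl, subst F_power) (simp only: mult_ac)
    finally show ?thesis by (simp add: atLeast0AtMost)
  qed
  have G: "G = Abs_fps (\<lambda>m. c m / fact m)"
    unfolding G_def binomial
    by (rule fps_ext) (simp add: c_def F_def fps_sum_nth sum_divide_distrib sum_distrib_left)
  \<comment> \<open>The zeroth moment is 1, so \<open>F 1 - 1\<close> has no constant term and its
    \<open>k\<close>-th power starts at degree \<open>k\<close> or later. This yields the vanishing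
    of the row below \<open>k\<close>.\<close>
  have "fps_nth (F 1) 0 = 1"
    by (simp add: F_def N.prob_space)
  then have "fps_nth G m = 0" if "m < k" for m
    using startsby_zero_power_prefix[of "F 1 - 1" k] that by (simp add: G_def)
  then have "c m = 0" if "m < k" for m
    using that by (simp add: G)
  moreover have "(\<lambda>t. 1 / fact k * (\<phi> t - 1) ^ k) has_fps_expansion G"
    unfolding G_def
    by (intro has_fps_expansion_cmult_left has_fps_expansion_power has_fps_expansion_diff phi
      has_fps_expansion_1)
  ultimately have "is_prob_lah_row M Y k c"
    by (simp add: is_prob_lah_row_iff_fps_expansion G \<phi>_def)
  then show ?thesis
    by (simp add: prob_lah_eqI c_def S_def)
qed

end
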